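(* Suppose that there exists a constant $N$ such that $\#\operatorname{PrePer}(f,K)\le N$ for every quadratic number field $K$ and every quadratic polynomial $f$ with coefficients in $K$. Then $N\ge 15$. Moreover, there are at least 46 pairwise non-isomorphic directed graphs that arise from the set $\operatorname{PrePer}(f,K)$ for such a field $K$ and polynomial $f$.
   Context: For a number field $K$ and a polynomial $f\in K[z]$ of degree 2, viewed as a map $f:\mathbb P^1(K)\to\mathbb P^1(K)$, a point $P\in\mathbb P^1(K)$ is preperiodic if its forward orbit $\{f^m(P):m\ge 0\}$ is finite; $\operatorname{PrePer}(f,K)$ denotes the set of all such points (it contains the fixed point $\infty$). This set is given the structure of a directed graph with vertex set $\operatorname{PrePer}(f,K)$ and a directed edge $P\to f(P)$ for each vertex $P$; graphs are counted up to isomorphism of directed graphs. *)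

theory Defs
  imports
    "Graph_Theory.Digraph_Isomorphism"
    "HOL-Algebra.Algebraic_Closure_Type"
    "HOL-Computational_Algebra.Polynomial"
    Complex_Main
begin

text \<open>
  Number fields are taken inside \<open>\<complex>\<close>: every extension of \<open>\<rat>\<close> of degree 2 embeds there, and
  transporting a polynomial along a field isomorphism preserves its preperiodic graph.
\<close>

definition quadratic_field :: "complex set \<Rightarrow> bool" where
  "quadratic_field K \<longleftrightarrow>
     subfield K (ring_of_type_algebra :: complex ring) \<and>
     ring.dimension (ring_of_type_algebra :: complex ring) 2 \<rat> K"

definition quadratic_poly_over :: "complex set \<Rightarrow> complex poly \<Rightarrow> bool" where
  "quadratic_poly_over K f \<longleftrightarrow>
     Polynomial.degree f = 2 \<and> (\<forall>i. Polynomial.coeff f i \<in> K)"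

text \<open>
  \<open>\<P>\<^sup>1(K) = K \<union> {\<infinity>}\<close>, where \<open>Some z\<close> is the affine point \<open>z\<close> and \<open>None\<close> is \<open>\<infinity>\<close>.
\<close>

definition proj_line :: "'a set \<Rightarrow> 'a option set" where
  "proj_line K = insert None (Some ` K)"

text \<open>A nonconstant polynomial acts on the projective line with \<open>f(\<infinity>) = \<infinity>\<close>.\<close>

definition proj_map :: "'a::comm_semiring_0 poly \<Rightarrow> 'a option \<Rightarrow> 'a option" where
  "proj_map f = map_option (poly f)"

definition preperiodic :: "('a \<Rightarrow> 'a) \<Rightarrow> 'a \<Rightarrow> bool" where
  "preperiodic F P \<longleftrightarrow> finite {(F ^^ m) P | m. m \<ge> 0}"

definition PrePer :: "complex poly \<Rightarrow> complex set \<Rightarrow> complex option set" where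
  "PrePer f K = {P \<in> proj_line K. preperiodic (proj_map f) P}"

definition preper_graph ::
  "complex poly \<Rightarrow> complex set \<Rightarrow> (complex option, complex option \<times> complex option) pre_digraph"
where
  "preper_graph f K =
     \<lparr> verts = PrePer f K,
       arcs = {(P, proj_map f P) | P. P \<in> PrePer f K},
       tail = fst,
       head = snd \<rparr>"

end

(*
  A preperiodic point z of z^2 + c in a quadratic field is confined to a finite set that can be
  listed. If D^2 c is in Z[sqrt d], then D z is a root of a monic polynomial over Z[sqrt d], so
  2 D z is in Z[sqrt d]; and z and its conjugate lie in the disc |z| <= R as soon as
  R^2 - R >= |c|, |c'|, because orbits starting outside run off to infinity. Hence
  z = (u + v sqrt d)/(2 D) with u^2 + |d| v^2 <= r^2, and following every such lattice point
  for a few steps determines the graph. The 46 pairs (d, c) come from a computer search. The graphs are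
  told apart by the numbers of pairs (x, y) of vertices with F^i x = F^j y and F^k x = F^l x for three
  choices of (i, j, k, l); one of them has 14 affine vertices.
*)
theory Submission
  imports Defs "HOL-Library.Product_Plus" "HOL-Computational_Algebra.Squarefree"
begin

section \<open>Quadratic fields\<close>

text \<open>The obstacle is completeness. That the listed points are preperiodic follows from a
  finite closed list, but the graph is known only once every other point of the field is shown to
  have infinite orbit. Everything is shaped so that this can be decided by integer arithmetic. Field
  elements are pairs of rational coordinates, and complex numbers enter only through the embedding
  \<open>sqrt_span s\<close>. Conjugation is the passage from \<open>s\<close> to
  \<open>- s\<close>: whatever depends on coordinates alone holds for both embeddings. The factor 2
  in \<open>2 * D\<close> is forced by integral elements such as (1 + sqrt 5)/2; it is obtained from
  trace and norm. The bounds on the two conjugates are added, so that one inequality covers real and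
  imaginary fields. The test for infinite orbits is one-sided, and this is enough because
  preperiodicity has its own certificate.\<close>

definition sqrt_span :: "complex \<Rightarrow> rat \<times> rat \<Rightarrow> complex" where
  "sqrt_span s p = of_rat (fst p) + of_rat (snd p) * s"

text \<open>With \<open>q = a / b\<close> in lowest terms, \<open>b^2\<close> divides
  \<open>d * a^2\<close>, hence \<open>d\<close>, so \<open>b\<close> is a unit. This gives the
  irrationality of the square root of \<open>d\<close> and later turns an integral discriminant into
  an integral coordinate.\<close>

lemma rat_square_squarefree:
  fixes d :: int and q :: rat
  assumes "squarefree d" "of_int d * q\<^sup>2 \<in> \<int>"
  shows "q \<in> \<int>"
proof -
  obtain a b where ab: "quotient_of q = (a, b)" by (cases "quotient_of q") auto
  have b: "b > 0" "coprime a b" "q = of_int a / of_int b"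
    using quotient_of_denom_pos[OF ab] quotient_of_coprime[OF ab] quotient_of_div[OF ab] by auto
  obtain n where n: "of_int d * q\<^sup>2 = of_int n" using assms(2) by (auto elim: Ints_cases)
  have "rat_of_int (d * a\<^sup>2) = of_int (n * b\<^sup>2)"
    using n b by (simp add: field_simps power2_eq_square)
  then have "d * a\<^sup>2 = n * b\<^sup>2" by (simp only: of_int_eq_iff)
  then have "b\<^sup>2 dvd d * a\<^sup>2" by simp
  moreover have "coprime (b\<^sup>2) (a\<^sup>2)" using b(2) by (simp add: coprime_commute)
  ultimately have "b\<^sup>2 dvd d" by (simp add: coprime_dvd_mult_left_iff)
  then have "b dvd 1" using assms(1) by (auto simp: squarefree_def)
  then have "b = 1" using b(1) by simp
  then show ?thesis using b(3) by simp
qed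

lemma squarefree_not_rat_square:
  fixes d :: int and q :: rat
  assumes "squarefree d" "d \<noteq> 1"
  shows "q\<^sup>2 \<noteq> of_int d"
proof
  assume q: "q\<^sup>2 = of_int d"
  have "of_int d * q\<^sup>2 = rat_of_int (d * d)" using q by simp
  then have "q \<in> \<int>" using rat_square_squarefree[OF assms(1)] by (metis Ints_of_int)
  then obtain n where "q = of_int n" by (auto elim: Ints_cases)
  with q have n: "n\<^sup>2 = d" by (metis of_int_eq_iff of_int_power)
  then have "n dvd 1" using assms(1) by (auto simp: squarefree_def)
  then have "n\<^sup>2 = 1" by (simp add: abs_square_eq_1)
  with n assms(2) show False by simp
qed

text \<open>Multiplication of Q[X]/(X^2 - d) in the basis 1, X. No root is chosen, so one
  computation serves both embeddings.\<close>

definition pair_mult :: "int \<Rightarrow> rat \<times> rat \<Rightarrow> rat \<times> rat \<Rightarrow> rat \<times> rat" where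
  "pair_mult d p q = (fst p * fst q + of_int d * snd p * snd q, fst p * snd q + snd p * fst q)"

lemma sqrt_span_pair_mult:
  assumes "s\<^sup>2 = of_int d"
  shows "sqrt_span s (pair_mult d p q) = sqrt_span s p * sqrt_span s q"
proof -
  have "sqrt_span s p * sqrt_span s q = of_rat (fst p) * of_rat (fst q)
      + of_rat (snd p) * of_rat (snd q) * s\<^sup>2 + (of_rat (fst p) * of_rat (snd q) + of_rat (snd p) * of_rat (fst q)) * s"
    by (simp add: sqrt_span_def algebra_simps power2_eq_square)
  then show ?thesis by (simp add: pair_mult_def sqrt_span_def assms of_rat_add of_rat_mult mult_ac)
qed

lemma sqrt_span_add: "sqrt_span s (p + q) = sqrt_span s p + sqrt_span s q"
  by (simp add: sqrt_span_def of_rat_add algebra_simps)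

text \<open>\<open>s\<close> may be either square root of \<open>d\<close>; instantiating the locale
  again at \<open>- s\<close> plays the part of Galois conjugation.\<close>

locale quadratic_root =
  fixes d :: int and s :: complex
  assumes squarefree: "squarefree d" and d_neq_1: "d \<noteq> 1" and s_square: "s\<^sup>2 = of_int d"
begin

lemma sqrt_span_eq_0_iff: "sqrt_span s p = 0 \<longleftrightarrow> p = 0"
proof
  assume 0: "sqrt_span s p = 0"
  obtain x y where p: "p = (x, y)" by (cases p)
  have "y = 0"
  proof (rule ccontr)
    assume y: "y \<noteq> 0"
    have "s = of_rat (- x / y)"
      using 0 y by (simp add: p sqrt_span_def of_rat_divide of_rat_minus field_simps add_eq_0_iff)
    then have "(of_rat ((- x / y)\<^sup>2) :: complex) = of_rat (of_int d)"
      using s_square by (simp only: of_rat_power of_rat_of_int_eq)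
    then show False using squarefree_not_rat_square[OF squarefree d_neq_1] of_rat_eq_iff by blast
  qed
  then show "p = 0" using 0 by (simp add: p sqrt_span_def zero_prod_def)
qed (simp add: sqrt_span_def)

lemma sqrt_span_diff: "sqrt_span s p - sqrt_span s q = sqrt_span s (p - q)"
  by (simp add: sqrt_span_def of_rat_diff algebra_simps)

lemma sqrt_span_eq_iff: "sqrt_span s p = sqrt_span s q \<longleftrightarrow> p = q"
  using sqrt_span_eq_0_iff[of "p - q"] sqrt_span_diff[of p q]
  by (metis eq_iff_diff_eq_0)

lemma conj: "quadratic_root d (- s)"
  using quadratic_root_axioms by (simp add: quadratic_root_def)

end

lemma range_sqrt_span: "range (sqrt_span s) = {of_rat x + of_rat y * s | x y. True}"
  by (auto simp: sqrt_span_def image_def)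

context quadratic_root
begin

text \<open>Rationalising the denominator: the product with the conjugate is the rational norm
  \<open>n\<close>, which is nonzero because both embeddings are injective.\<close>

lemma sqrt_span_inverse:
  "inverse (sqrt_span s p) \<in> range (sqrt_span s)"
proof (cases "p = 0")
  case True
  then have "inverse (sqrt_span s p) = sqrt_span s 0" by (simp add: sqrt_span_def)
  then show ?thesis by blast
next
  case False
  obtain x y where p: "p = (x, y)" by (cases p)
  define n where "n = x\<^sup>2 - of_int d * y\<^sup>2"
  have prod: "sqrt_span s p * sqrt_span (- s) p = of_rat n"
    using s_square
    by (simp add: p sqrt_span_def n_def of_rat_diff of_rat_mult of_rat_power algebra_simps power2_eq_square)
  have "sqrt_span s p \<noteq> 0" "sqrt_span (- s) p \<noteq> 0"
    using False sqrt_span_eq_0_iff quadratic_root.sqrt_span_eq_0_iff[OF conj] by auto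
  then have "n \<noteq> 0" using prod by auto
  then have "inverse (sqrt_span s p) = sqrt_span (- s) p / of_rat n"
    using prod \<open>sqrt_span s p \<noteq> 0\<close> by (simp add: field_simps)
  also have "\<dots> = sqrt_span s (x / n, - y / n)"
    using \<open>n \<noteq> 0\<close> by (simp add: p sqrt_span_def of_rat_divide of_rat_minus diff_divide_distrib)
  finally show ?thesis by blast
qed

lemma quadratic_field_range_sqrt_span: "quadratic_field (range (sqrt_span s))"
proof -
  let ?C = "ring_of_type_algebra :: complex ring"
  let ?K = "range (sqrt_span s)"
  interpret C: field ?C by (rule field_from_type_algebra)
  have C [simp]: "carrier ?C = UNIV" "x \<oplus>\<^bsub>?C\<^esub> y = x + y" "x \<otimes>\<^bsub>?C\<^esub> y = x * y"
      "\<zero>\<^bsub>?C\<^esub> = 0" "\<one>\<^bsub>?C\<^esub> = 1" for x y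
    by (simp_all add: ring_of_type_algebra_def)
  have minus [simp]: "\<ominus>\<^bsub>?C\<^esub> x = - x" for x
    using C.minus_equality[of "- x" x] by simp
  have inv [simp]: "inv\<^bsub>?C\<^esub> x = inverse x" if "x \<noteq> 0" for x
    using that by (intro C.inv_char) auto
  have um: "- sqrt_span s p = sqrt_span s (- p)" for p
    by (simp add: sqrt_span_def of_rat_minus algebra_simps)
  have one: "1 = sqrt_span s (1, 0)" by (simp add: sqrt_span_def)
  have sub: "subring ?K ?C"
    using um one
    by (intro C.subringI) (auto simp flip: sqrt_span_add sqrt_span_pair_mult[OF s_square])
  have subfield: "subfield ?K ?C"
    using sub sqrt_span_inverse by (intro C.subfieldI') (auto simp: image_iff)
  have line: "C.line_extension \<rat> v E = {k * v + e | k e. k \<in> \<rat> \<and> e \<in> E}" for v E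
    by (auto simp: C.line_extension_def set_add_def set_mult_def r_coset_def)
  have span1: "C.Span \<rat> [1] = \<rat>"
    by (simp add: line)
  have "s \<notin> \<rat>"
  proof
    assume "s \<in> \<rat>"
    then obtain q where "s = of_rat q" by (auto elim: Rats_cases)
    then have "sqrt_span s (q, -1) = 0" by (simp add: sqrt_span_def of_rat_minus)
    then show False by (simp add: sqrt_span_eq_0_iff zero_prod_def)
  qed
  then have "C.independent \<rat> [s, 1]"
    by (intro C.li_Cons C.li_Nil) (simp_all only: span1 C, simp_all)
  then have "C.dimension (length [s, 1]) \<rat> (C.Span \<rat> [s, 1])"
    by (rule C.dimension_independent)
  moreover have "C.Span \<rat> [s, 1] = ?K"
  proof -
    have "C.Span \<rat> [s, 1] = C.line_extension \<rat> s (C.Span \<rat> [1])" by simp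
    also have "\<dots> = {of_rat y * s + of_rat x | y x. True}"
      unfolding span1 line by (auto simp: Rats_def)
    also have "\<dots> = ?K" by (auto simp: range_sqrt_span add.commute)
    finally show ?thesis .
  qed
  ultimately show ?thesis using subfield by (simp add: quadratic_field_def numeral_2_eq_2)
qed

end

section \<open>Integrality over the ring generated by a square root\<close>

text \<open>A denominator \<open>b \<ge> 2\<close> would give \<open>b ^ k\<close> dividing
  \<open>M\<close> for every \<open>k\<close>. One multiplier for all powers is the form of
  integrality used here: it passes to sums and products without constructing their
  equations.\<close>

lemma rat_bounded_denominator_powers:
  fixes q :: rat and M :: int
  assumes "M \<noteq> 0" "\<And>k. of_int M * q ^ k \<in> \<int>"
  shows "q \<in> \<int>"
proof -
  obtain a b where ab: "quotient_of q = (a, b)" by (cases "quotient_of q") auto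
  have b: "b > 0" "coprime a b" "q = of_int a / of_int b"
    using quotient_of_denom_pos[OF ab] quotient_of_coprime[OF ab] quotient_of_div[OF ab] by auto
  have "b = 1"
  proof (rule ccontr)
    assume "b \<noteq> 1"
    then have b2: "b \<ge> 2" using b(1) by simp
    \<comment> \<open>Any \<open>k\<close> with \<open>2 ^ k > \<bar>M\<bar>\<close> works, and
      \<open>k < 2 ^ k\<close> always holds.\<close>
    define k where "k = nat \<bar>M\<bar>"
    obtain n where "of_int M * q ^ k = of_int n" using assms(2) by (auto elim: Ints_cases)
    then have "rat_of_int (M * a ^ k) = of_int (n * b ^ k)"
      using b by (simp add: power_divide field_simps)
    then have "M * a ^ k = n * b ^ k" by (simp only: of_int_eq_iff)
    then have "b ^ k dvd M * a ^ k" by simp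
    moreover have "coprime (b ^ k) (a ^ k)" using b(2) by (simp add: coprime_commute)
    ultimately have "b ^ k dvd M" by (simp add: coprime_dvd_mult_left_iff)
    then have "b ^ k \<le> \<bar>M\<bar>" using dvd_imp_le_int[OF assms(1), of "b ^ k"] b(1) by (simp add: power_abs)
    moreover have "2 ^ k \<le> b ^ k" using b2 by (intro power_mono) auto
    moreover have "int k < 2 ^ k" using of_nat_less_two_power by blast
    ultimately show False by (simp add: k_def)
  qed
  then show ?thesis using b(3) by simp
qed

definition int_span :: "complex \<Rightarrow> complex set" where
  "int_span s = {of_int a + of_int b * s | a b. True}"

lemma of_int_in_int_span: "of_int a \<in> int_span s"
proof -
  have "of_int a = of_int a + of_int 0 * s" by simp
  then show ?thesis unfolding int_span_def by blast
qed

lemma int_span_add: "z \<in> int_span s \<Longrightarrow> w \<in> int_span s \<Longrightarrow> z + w \<in> int_span s"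
proof -
  assume "z \<in> int_span s" "w \<in> int_span s"
  then obtain a b a' b' where "z = of_int a + of_int b * s" "w = of_int a' + of_int b' * s"
    by (auto simp: int_span_def)
  then have "z + w = of_int (a + a') + of_int (b + b') * s" by (simp add: algebra_simps)
  then show ?thesis unfolding int_span_def by blast
qed

lemma int_span_uminus: "z \<in> int_span s \<Longrightarrow> - z \<in> int_span s"
proof -
  assume "z \<in> int_span s"
  then obtain a b where "z = of_int a + of_int b * s" by (auto simp: int_span_def)
  then have "- z = of_int (- a) + of_int (- b) * s" by (simp add: algebra_simps)
  then show ?thesis unfolding int_span_def by blast
qed

lemma int_span_minus_root: "int_span (- s) \<subseteq> int_span s"
proof
  fix z assume "z \<in> int_span (- s)"
  then obtain a b where "z = of_int a + of_int b * (- s)" by (auto simp: int_span_def)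
  then have "z = of_int a + of_int (- b) * s" by simp
  then show "z \<in> int_span s" unfolding int_span_def by blast
qed

lemma int_span_sum: "(\<And>i. i \<in> I \<Longrightarrow> g i \<in> int_span s) \<Longrightarrow> sum g I \<in> int_span s"
  using of_int_in_int_span[of 0] by (induction I rule: infinite_finite_induct) (auto intro: int_span_add)

text \<open>The coordinates of a power are the same for \<open>s\<close> and \<open>- s\<close>.
  This is how denominators are carried over to the conjugate.\<close>

lemma sqrt_span_power:
  assumes "s\<^sup>2 = of_int d"
  shows "sqrt_span s ((pair_mult d p ^^ k) (1, 0)) = sqrt_span s p ^ k"
proof (induction k)
  case 0
  show ?case by (simp add: sqrt_span_def)
qed (simp add: sqrt_span_pair_mult[OF assms])

context quadratic_root
begin

lemma int_span_mult: "z \<in> int_span s \<Longrightarrow> w \<in> int_span s \<Longrightarrow> z * w \<in> int_span s"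
proof -
  assume "z \<in> int_span s" "w \<in> int_span s"
  then obtain a b a' b' where zw: "z = of_int a + of_int b * s" "w = of_int a' + of_int b' * s"
    by (auto simp: int_span_def)
  have "z * w = of_int a * of_int a' + of_int b * of_int b' * s\<^sup>2 + of_int (a * b' + b * a') * s"
    unfolding zw by (simp add: algebra_simps power2_eq_square)
  then have "z * w = of_int (a * a' + d * b * b') + of_int (a * b' + b * a') * s"
    by (simp add: s_square)
  then show ?thesis unfolding int_span_def by blast
qed

lemma int_span_power: "z \<in> int_span s \<Longrightarrow> z ^ k \<in> int_span s"
  using of_int_in_int_span[of 1] by (induction k) (auto intro: int_span_mult)

lemma int_span_iff_Ints: "of_int M * sqrt_span s p \<in> int_span s \<longleftrightarrow> of_int M * fst p \<in> \<int> \<and> of_int M * snd p \<in> \<int>"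
proof
  assume "of_int M * sqrt_span s p \<in> int_span s"
  then obtain a b where "of_int M * sqrt_span s p = of_int a + of_int b * s"
    by (auto simp: int_span_def)
  then have "sqrt_span s (of_int M * fst p, of_int M * snd p) = sqrt_span s (of_int a, of_int b)"
    by (simp add: sqrt_span_def of_rat_mult algebra_simps)
  then show "of_int M * fst p \<in> \<int> \<and> of_int M * snd p \<in> \<int>"
    by (simp only: sqrt_span_eq_iff) auto
next
  assume "of_int M * fst p \<in> \<int> \<and> of_int M * snd p \<in> \<int>"
  then obtain a b where ab: "of_int M * fst p = of_int a" "of_int M * snd p = of_int b"
    by (auto elim!: Ints_cases)
  have "of_int M * sqrt_span s p = of_rat (of_int M * fst p) + of_rat (of_int M * snd p) * s"
    by (simp add: sqrt_span_def of_rat_mult algebra_simps)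
  then have "of_int M * sqrt_span s p = of_int a + of_int b * s" by (simp only: ab of_rat_of_int_eq)
  then show "of_int M * sqrt_span s p \<in> int_span s" unfolding int_span_def by blast
qed

lemma of_rat_in_int_span: "of_rat q \<in> int_span s \<Longrightarrow> q \<in> \<int>"
  using int_span_iff_Ints[of 1 "(q, 0)"] by (simp add: sqrt_span_def)

lemma ex_common_denominator: "\<exists>M > 0. of_int M * sqrt_span s p \<in> int_span s"
proof -
  obtain a b where ab: "quotient_of (fst p) = (a, b)" by (cases "quotient_of (fst p)") auto
  obtain a' b' where ab': "quotient_of (snd p) = (a', b')" by (cases "quotient_of (snd p)") auto
  have b: "b > 0" "fst p = of_int a / of_int b"
    using quotient_of_denom_pos[OF ab] quotient_of_div[OF ab] by auto
  have b': "b' > 0" "snd p = of_int a' / of_int b'"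
    using quotient_of_denom_pos[OF ab'] quotient_of_div[OF ab'] by auto
  have "of_int (b * b') * fst p = of_int (b' * a)" "of_int (b * b') * snd p = of_int (b * a')"
    using b b' by simp_all
  then have "of_int (b * b') * sqrt_span s p \<in> int_span s"
    by (simp only: int_span_iff_Ints) auto
  then show ?thesis using b(1) b'(1) by (intro exI[of _ "b * b'"]) auto
qed

text \<open>The monic equation expresses \<open>W ^ N\<close> by lower powers with coefficients in
  the ring, so a multiplier that clears the powers below \<open>N\<close> clears all of
  them.\<close>

lemma bounded_denominator_powers:
  assumes coeffs: "\<And>i. Polynomial.coeff p i \<in> int_span s" and monic: "lead_coeff p = 1"
    and root: "poly p (sqrt_span s w) = 0"
  shows "\<exists>M > 0. \<forall>k. of_int M * sqrt_span s w ^ k \<in> int_span s"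
proof -
  define W where "W = sqrt_span s w"
  define N where "N = Polynomial.degree p"
  obtain M0 where M0: "M0 > 0" "of_int M0 * W \<in> int_span s"
    using ex_common_denominator W_def by blast
  have top: "W ^ N = - (\<Sum>i<N. Polynomial.coeff p i * W ^ i)"
    using root monic by (simp add: poly_altdef W_def N_def lessThan_Suc_atMost[symmetric] add_eq_0_iff)
  have "of_int (M0 ^ N) * W ^ k \<in> int_span s" for k
  proof (induction k rule: less_induct)
    case (less k)
    show ?case
    proof (cases "k < N")
      case True
      \<comment> \<open>For \<open>k < N\<close> there is a factor \<open>M0\<close> for each of the
        \<open>k\<close> copies of \<open>W\<close>.\<close>
      then have "of_int (M0 ^ N) * W ^ k = of_int (M0 ^ (N - k)) * (of_int M0 * W) ^ k"
        by (simp add: power_mult_distrib power_add[symmetric] mult.assoc[symmetric])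
      then show ?thesis using M0(2) of_int_in_int_span int_span_mult int_span_power by metis
    next
      case False
      then have "of_int (M0 ^ N) * W ^ k = of_int (M0 ^ N) * (W ^ (k - N) * W ^ N)"
        by (simp add: power_add[symmetric])
      also have "\<dots> = - (\<Sum>i<N. Polynomial.coeff p i * (of_int (M0 ^ N) * W ^ (k - N + i)))"
        unfolding top by (simp add: sum_distrib_left power_add mult_ac)
      also have "\<dots> \<in> int_span s"
        using False by (intro int_span_uminus int_span_sum int_span_mult coeffs less) auto
      finally show ?thesis .
    qed
  qed
  then show ?thesis using M0(1) W_def by (metis zero_less_power)
qed

text \<open>The trace \<open>t\<close> and the norm \<open>n\<close> are rational and all their
  powers have a common denominator, so they are integers. Then
  \<open>t^2 - 4 * n = d * (2 * snd w)^2\<close> is an integer, and squarefreeness handles the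
  second coordinate.\<close>

lemma integral_imp_half_int_span:
  assumes coeffs: "\<And>i. Polynomial.coeff p i \<in> int_span s" and monic: "lead_coeff p = 1"
    and root: "poly p (sqrt_span s w) = 0"
  shows "2 * fst w \<in> \<int>" "2 * snd w \<in> \<int>"
proof -
  define W where "W = sqrt_span s w"
  define W' where "W' = sqrt_span (- s) w"
  obtain M where M: "M > 0" "\<And>k. of_int M * W ^ k \<in> int_span s"
    using bounded_denominator_powers[OF assms] W_def by auto
  \<comment> \<open>\<open>W'\<close> need not be a root of \<open>p\<close>, whose coefficients may
    be irrational; the bound holds because \<open>W ^ k\<close> and \<open>W' ^ k\<close> share
    their coordinates.\<close>
  have M': "of_int M * W' ^ k \<in> int_span s" for k
  proof -
    interpret conj: quadratic_root d "- s" by (rule conj)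
    have "of_int M * W' ^ k \<in> int_span (- s)"
      using M(2)[of k] unfolding W_def W'_def sqrt_span_power[OF s_square, symmetric]
        sqrt_span_power[OF conj.s_square, symmetric] int_span_iff_Ints conj.int_span_iff_Ints .
    then show ?thesis using int_span_minus_root by blast
  qed
  define t n where "t = 2 * fst w" and "n = (fst w)\<^sup>2 - of_int d * (snd w)\<^sup>2"
  have t: "of_rat t = W + W'"
    by (simp add: t_def W_def W'_def sqrt_span_def of_rat_mult)
  have n: "of_rat n = W * W'"
    using s_square
    by (simp add: W_def W'_def sqrt_span_def n_def of_rat_diff of_rat_mult of_rat_power algebra_simps power2_eq_square)
  have "t \<in> \<int>"
  proof (rule rat_bounded_denominator_powers)
    show "M\<^sup>2 \<noteq> 0" using M(1) by simp
    fix k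
    have "of_rat (of_int (M\<^sup>2) * t ^ k) = of_int (M\<^sup>2) * (W + W') ^ k"
      by (simp only: of_rat_mult of_rat_power of_rat_of_int_eq t)
    \<comment> \<open>One factor \<open>M\<close> goes to the power of \<open>W\<close> and one to
      the power of \<open>W'\<close>, hence the multiplier \<open>M^2\<close>.\<close>
    also have "\<dots> = (\<Sum>i\<le>k. of_int (int (k choose i)) * ((of_int M * W ^ i) * (of_int M * W' ^ (k - i))))"
      by (simp add: binomial_ring sum_distrib_left power2_eq_square mult_ac)
    also have "\<dots> \<in> int_span s"
      by (intro int_span_sum int_span_mult of_int_in_int_span M M')
    finally show "of_int (M\<^sup>2) * t ^ k \<in> \<int>" by (rule of_rat_in_int_span)
  qed
  moreover have "n \<in> \<int>"
  proof (rule rat_bounded_denominator_powers)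
    show "M\<^sup>2 \<noteq> 0" using M(1) by simp
    fix k
    have "of_rat (of_int (M\<^sup>2) * n ^ k) = of_int (M\<^sup>2) * (W * W') ^ k"
      by (simp only: of_rat_mult of_rat_power of_rat_of_int_eq n)
    also have "\<dots> = (of_int M * W ^ k) * (of_int M * W' ^ k)"
      by (simp add: power_mult_distrib power2_eq_square mult_ac)
    also have "\<dots> \<in> int_span s" by (intro int_span_mult M M')
    finally show "of_int (M\<^sup>2) * n ^ k \<in> \<int>" by (rule of_rat_in_int_span)
  qed
  ultimately have "t\<^sup>2 - 4 * n \<in> \<int>" by simp
  moreover have "t\<^sup>2 - 4 * n = of_int d * (2 * snd w)\<^sup>2"
    by (simp add: t_def n_def power_mult_distrib)
  ultimately show "2 * snd w \<in> \<int>" using rat_square_squarefree[OF squarefree] by metis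
  show "2 * fst w \<in> \<int>" using \<open>t \<in> \<int>\<close> t_def by simp
qed

end

section \<open>Preperiodic points\<close>

text \<open>An injective semiconjugacy maps orbits bijectively. It is used for coordinates inside
  the complex numbers and for these inside the projective line.\<close>

lemma preperiodic_conjugate:
  assumes "\<And>x. \<phi> (F x) = G (\<phi> x)" "inj \<phi>"
  shows "preperiodic G (\<phi> x) \<longleftrightarrow> preperiodic F x"
proof -
  have iter: "(G ^^ m) (\<phi> x) = \<phi> ((F ^^ m) x)" for m
    by (induction m) (simp_all add: assms(1))
  have "{(G ^^ m) (\<phi> x) | m. m \<ge> 0} = \<phi> ` {(F ^^ m) x | m. m \<ge> 0}"
    by (auto simp: iter)
  moreover have "inj_on \<phi> {(F ^^ m) x | m. m \<ge> 0}"
    using assms(2) by (rule inj_on_subset) simp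
  ultimately show ?thesis
    unfolding preperiodic_def by (simp only: finite_image_iff)
qed

lemma preperiodic_closed:
  assumes "finite V" "\<And>x. x \<in> V \<Longrightarrow> F x \<in> V" "x \<in> V"
  shows "preperiodic F x"
proof -
  have "(F ^^ m) x \<in> V" for m by (induction m) (auto simp: assms)
  then have "{(F ^^ m) x | m. m \<ge> 0} \<subseteq> V" by auto
  then show ?thesis using assms(1) finite_subset by (auto simp: preperiodic_def)
qed

lemma preperiodic_step:
  assumes "preperiodic F x"
  shows "preperiodic F (F x)"
proof -
  have "(F ^^ m) (F x) = (F ^^ Suc m) x" for m by (simp only: funpow_Suc_right comp_apply)
  then have "{(F ^^ m) (F x) | m. m \<ge> 0} \<subseteq> {(F ^^ m) x | m. m \<ge> 0}" by blast
  then show ?thesis using assms finite_subset by (auto simp: preperiodic_def)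
qed

lemma preperiodic_collision:
  assumes "preperiodic F x"
  shows "\<exists>m n. n < m \<and> (F ^^ m) x = (F ^^ n) x"
proof -
  have "finite (range (\<lambda>m. (F ^^ m) x))"
    using assms by (simp add: preperiodic_def full_SetCompr_eq)
  then have "\<not> inj (\<lambda>m. (F ^^ m) x)" using finite_imageD by blast
  then show ?thesis by (metis injI linorder_neqE_nat)
qed

text \<open>Beyond \<open>B\<close> the distance to the disc of radius \<open>B\<close> at least doubles with every step.\<close>

lemma preperiodic_norm_le:
  fixes z c :: complex
  assumes B: "B \<ge> 1" "norm c \<le> B\<^sup>2 - B" and pre: "preperiodic (\<lambda>z. z\<^sup>2 + c) z"
  shows "norm z \<le> B"
proof (rule ccontr)
  let ?F = "\<lambda>z. z\<^sup>2 + c"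
  define t where "t = norm z - B"
  assume "\<not> norm z \<le> B"
  then have t: "t > 0" by (simp add: t_def)
  have growth: "norm ((?F ^^ m) z) \<ge> B + 2 ^ m * t" for m
  proof (induction m)
    case (Suc m)
    define w where "w = (?F ^^ m) z"
    define T where "T = 2 ^ m * t"
    have T: "T > 0" "norm w \<ge> B + T" using t Suc by (auto simp: T_def w_def)
    have "norm (w\<^sup>2 + c) \<ge> norm (w\<^sup>2) - norm c" by (rule norm_diff_ineq)
    moreover have "(norm w)\<^sup>2 \<ge> (B + T)\<^sup>2" using T B by (intro power_mono) auto
    moreover have "(B + T)\<^sup>2 \<ge> B\<^sup>2 + 2 * T"
    proof -
      have "T \<le> B * T" using T B mult_right_mono[of 1 B T] by simp
      moreover have "(B + T)\<^sup>2 = B\<^sup>2 + 2 * (B * T) + T\<^sup>2" by (simp add: power2_sum)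
      moreover have "T\<^sup>2 \<ge> 0" by simp
      ultimately show ?thesis by linarith
    qed
    ultimately have "norm (w\<^sup>2 + c) \<ge> B + 2 * T" using B(2) by (simp add: norm_power)
    then show ?case by (simp add: w_def T_def)
  qed (simp add: t_def)
  have fin: "finite (range (\<lambda>m. (?F ^^ m) z))"
    using pre by (simp add: preperiodic_def full_SetCompr_eq)
  define M where "M = Max (norm ` range (\<lambda>m. (?F ^^ m) z))"
  have M: "norm ((?F ^^ m) z) \<le> M" for m
    unfolding M_def by (intro Max_ge) (use fin in auto)
  obtain m where "M / t < 2 ^ m" using real_arch_pow[of 2 "M / t"] by auto
  then have "M < 2 ^ m * t" using t by (simp add: field_simps)
  then show False using growth[of m] M[of m] B(1) by linarith
qed

section \<open>Integrality and size of preperiodic points\<close>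

context quadratic_root
begin

lemma coeff_power2_in_int_span:
  assumes "\<And>i. Polynomial.coeff p i \<in> int_span s"
  shows "Polynomial.coeff (p\<^sup>2) i \<in> int_span s"
  by (simp add: power2_eq_square Polynomial.coeff_mult) (intro int_span_sum int_span_mult assms)

text \<open>In the variable \<open>D * z\<close> the scaled iterates obey
  \<open>q = p^2 + D^(2^(m+1)) * c\<close>. The exponent is at least 2, so the added constant is a
  multiple of \<open>D^2 * c\<close> and lies in the ring.\<close>

lemma iterate_monic_poly:
  assumes c: "of_int D ^ 2 * c \<in> int_span s"
  shows "\<exists>p. (\<forall>i. Polynomial.coeff p i \<in> int_span s) \<and> lead_coeff p = 1 \<and> Polynomial.degree p = 2 ^ m \<and>
    poly p (of_int D * z) = of_int D ^ (2 ^ m) * ((\<lambda>z. z\<^sup>2 + c) ^^ m) z"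
proof (induction m)
  case 0
  have "Polynomial.coeff [:0, 1:] i \<in> int_span s" for i
    using of_int_in_int_span[of 0] of_int_in_int_span[of 1] by (auto simp: coeff_pCons split: nat.splits)
  then show ?case by (intro exI[of _ "[:0, 1:]"]) auto
next
  case (Suc m)
  then obtain p where p: "\<And>i. Polynomial.coeff p i \<in> int_span s" "lead_coeff p = 1"
      "Polynomial.degree p = 2 ^ m" "poly p (of_int D * z) = of_int D ^ (2 ^ m) * ((\<lambda>z. z\<^sup>2 + c) ^^ m) z"
    by blast
  define e where "e = of_int D ^ (2 ^ Suc m) * c"
  define q where "q = p\<^sup>2 + [:e:]"
  have le: "(2::nat) \<le> 2 ^ Suc m" by (rule self_le_power) simp_all
  have "(of_int D :: complex) ^ (2 ^ Suc m) = of_int D ^ 2 * of_int D ^ (2 ^ Suc m - 2)"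
    by (simp only: power_add[symmetric] le_add_diff_inverse[OF le])
  then have "e = of_int (D ^ (2 ^ Suc m - 2)) * (of_int D ^ 2 * c)"
    unfolding e_def by (simp only: of_int_power mult_ac)
  then have e: "e \<in> int_span s" using c of_int_in_int_span int_span_mult by metis
  have deg2: "Polynomial.degree (p\<^sup>2) = 2 ^ Suc m"
    using p(2,3) by (subst degree_power_eq) auto
  have deg: "Polynomial.degree q = 2 ^ Suc m"
    unfolding q_def using deg2 by (subst degree_add_eq_left) auto
  have "Polynomial.coeff q (2 ^ Suc m) = Polynomial.coeff (p\<^sup>2) (2 ^ Suc m)"
    by (simp add: q_def coeff_pCons split: nat.split)
  also have "\<dots> = 1" using p(2) deg2 by (metis lead_coeff_power power_one)
  finally have "lead_coeff q = 1" using deg by simp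
  moreover have "Polynomial.coeff q i \<in> int_span s" for i
    using coeff_power2_in_int_span[OF p(1)] e of_int_in_int_span[of 0]
    by (auto simp: q_def coeff_pCons split: nat.split intro!: int_span_add)
  moreover have "((of_int D :: complex) ^ (2 ^ m))\<^sup>2 = of_int D ^ (2 ^ Suc m)"
    by (simp only: power_mult[symmetric] power_Suc2)
  then have "poly q (of_int D * z) = of_int D ^ (2 ^ Suc m) * ((\<lambda>z. z\<^sup>2 + c) ^^ Suc m) z"
    by (simp add: q_def p(4) e_def distrib_left power_mult_distrib del: power_Suc)
  ultimately show ?case using deg by blast
qed

text \<open>A collision of the iterates \<open>n < m\<close> makes \<open>D * z\<close> a root of a
  combination of two monic polynomials; their degrees differ, so the combination stays
  monic.\<close>

lemma preperiodic_half_integral: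
  assumes "of_int D ^ 2 * c \<in> int_span s" "preperiodic (\<lambda>z. z\<^sup>2 + c) (sqrt_span s w)"
  shows "of_int (2 * D) * fst w \<in> \<int>" "of_int (2 * D) * snd w \<in> \<int>"
proof -
  let ?F = "\<lambda>z. z\<^sup>2 + c"
  let ?z = "sqrt_span s w"
  obtain m n where mn: "n < m" "(?F ^^ m) ?z = (?F ^^ n) ?z"
    using preperiodic_collision[OF assms(2)] by blast
  obtain p where p: "\<And>i. Polynomial.coeff p i \<in> int_span s" "lead_coeff p = 1"
      "Polynomial.degree p = 2 ^ m" "poly p (of_int D * ?z) = of_int D ^ (2 ^ m) * (?F ^^ m) ?z"
    using iterate_monic_poly[OF assms(1)] by blast
  obtain q where q: "\<And>i. Polynomial.coeff q i \<in> int_span s" "lead_coeff q = 1"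
      "Polynomial.degree q = 2 ^ n" "poly q (of_int D * ?z) = of_int D ^ (2 ^ n) * (?F ^^ n) ?z"
    using iterate_monic_poly[OF assms(1)] by blast
  \<comment> \<open>This factor brings the \<open>n\<close>-th iterate from the scale
    \<open>D ^ (2 ^ n)\<close> to \<open>D ^ (2 ^ m)\<close>, so that the two values cancel.\<close>
  define e where "e = - ((of_int D :: complex) ^ (2 ^ m - 2 ^ n))"
  define P where "P = p + Polynomial.smult e q"
  have less: "(2::nat) ^ n < 2 ^ m" using mn(1) by simp
  have "Polynomial.degree (Polynomial.smult e q) < Polynomial.degree p"
    using less p(3) q(3) by (metis degree_smult_le le_less_trans)
  then have deg: "Polynomial.degree P = Polynomial.degree p"
    and "Polynomial.coeff (Polynomial.smult e q) (Polynomial.degree p) = 0"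
    unfolding P_def by (rule degree_add_eq_left, rule coeff_eq_0)
  then have monic: "lead_coeff P = 1"
    using p(2) by (simp only: deg) (simp only: P_def coeff_add add_0_right)
  have e: "e \<in> int_span s"
    unfolding e_def using of_int_in_int_span[of D] by (intro int_span_uminus int_span_power)
  have coeffs: "Polynomial.coeff P i \<in> int_span s" for i
    unfolding P_def coeff_add coeff_smult by (intro int_span_add int_span_mult e p q)
  have "e * of_int D ^ (2 ^ n) = - (of_int D ^ (2 ^ m))"
    using less by (simp add: e_def power_add[symmetric])
  then have root: "poly P (of_int D * ?z) = 0"
    by (simp add: P_def p(4) q(4) mn(2) mult.assoc[symmetric])
  have Dz: "of_int D * ?z = sqrt_span s (of_int D * fst w, of_int D * snd w)"
    by (simp add: sqrt_span_def of_rat_mult algebra_simps)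
  show "of_int (2 * D) * fst w \<in> \<int>" "of_int (2 * D) * snd w \<in> \<int>"
    using integral_imp_half_int_span[OF coeffs monic root[unfolded Dz]] by (simp_all add: mult.assoc)
qed

text \<open>The parallelogram law together with \<open>(norm s)^2 = \<bar>d\<bar>\<close>, whatever
  the sign of \<open>d\<close>. It merges two disc bounds into one ellipse.\<close>

lemma norm_sqrt_span_square_sum:
  "(norm (sqrt_span s (x, y)))\<^sup>2 + (norm (sqrt_span (- s) (x, y)))\<^sup>2
     = 2 * ((of_rat x)\<^sup>2 + of_int \<bar>d\<bar> * (of_rat y)\<^sup>2)"
proof -
  have rat: "(of_rat q :: complex) = of_real (of_rat q)" for q
    by (cases q) (simp add: of_rat_rat)
  have "\<bar>of_int d\<bar> = (norm s)\<^sup>2"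
    using s_square by (metis norm_of_int norm_power)
  then have d: "of_int \<bar>d\<bar> = (Re s)\<^sup>2 + (Im s)\<^sup>2" by (simp add: cmod_power2)
  show ?thesis
    unfolding cmod_power2 d by (simp add: sqrt_span_def rat power2_eq_square algebra_simps)
qed

definition quadratic_step :: "rat \<times> rat \<Rightarrow> rat \<times> rat \<Rightarrow> rat \<times> rat" where
  "quadratic_step c p = pair_mult d p p + c"

lemma preperiodic_sqrt_span_iff:
  "preperiodic (\<lambda>z. z\<^sup>2 + sqrt_span s c) (sqrt_span s p) \<longleftrightarrow> preperiodic (quadratic_step c) p"
proof (rule preperiodic_conjugate)
  show "inj (sqrt_span s)" by (simp add: inj_def sqrt_span_eq_iff)
qed (simp add: quadratic_step_def sqrt_span_add sqrt_span_pair_mult[OF s_square] power2_eq_square)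

end

text \<open>Both sides amount to preperiodicity under \<open>quadratic_step\<close>, which depends
  on \<open>d\<close> but not on the chosen root.\<close>

lemma (in quadratic_root) preperiodic_conj_iff:
  "preperiodic (\<lambda>z. z\<^sup>2 + sqrt_span (- s) c) (sqrt_span (- s) p) \<longleftrightarrow>
   preperiodic (\<lambda>z. z\<^sup>2 + sqrt_span s c) (sqrt_span s p)"
  using quadratic_root.preperiodic_sqrt_span_iff[OF conj] preperiodic_sqrt_span_iff by simp

text \<open>The inequalities encode \<open>4 |A| + 4 |B| sqrt |d| \<le> r^2 - 2 D r\<close> over the
  integers: the root term is isolated and squared, the other side being nonnegative. Division by
  \<open>4 * D^2\<close> bounds both conjugates of the parameter by \<open>b^2 - b\<close> for the
  radius \<open>b = r / (2 * D)\<close>.\<close>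

lemma (in quadratic_root) preperiodic_bound:
  fixes A B D r :: int
  defines "c \<equiv> (of_int A / of_int D ^ 2, of_int B / of_int D ^ 2) :: rat \<times> rat"
  assumes D: "D > 0" and r: "2 * D \<le> r" "4 * \<bar>A\<bar> \<le> r\<^sup>2 - 2 * D * r"
      "16 * B\<^sup>2 * \<bar>d\<bar> \<le> (r\<^sup>2 - 2 * D * r - 4 * \<bar>A\<bar>)\<^sup>2"
    and pre: "preperiodic (\<lambda>z. z\<^sup>2 + sqrt_span s c) (sqrt_span s p)"
  shows "\<exists>u v. p = (of_int u / of_int (2 * D), of_int v / of_int (2 * D)) \<and> u\<^sup>2 + \<bar>d\<bar> * v\<^sup>2 \<le> r\<^sup>2"
proof -
  define b :: real where "b = of_int r / of_int (2 * D)"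
  have b1: "b \<ge> 1" using D r(1) by (simp add: b_def)
  have "of_int D ^ 2 * sqrt_span s c = of_int A + of_int B * s"
    using D by (simp add: c_def sqrt_span_def of_rat_divide of_rat_power field_simps)
  then have "of_int D ^ 2 * sqrt_span s c \<in> int_span s" unfolding int_span_def by blast
  from preperiodic_half_integral[OF this pre]
  obtain u v where uv: "of_int (2 * D) * fst p = of_int u" "of_int (2 * D) * snd p = of_int v"
    by (auto elim!: Ints_cases)
  then have p: "p = (of_int u / of_int (2 * D), of_int v / of_int (2 * D))"
    using D by (simp add: prod_eq_iff field_simps)
  have s_norm: "(norm s)\<^sup>2 = of_int \<bar>d\<bar>"
    using s_square by (metis norm_of_int norm_power of_int_abs)
  have "norm t \<le> b\<^sup>2 - b" if t: "t = sqrt_span s c \<or> t = sqrt_span (- s) c" for t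
  proof -
    define m where "m = r\<^sup>2 - 2 * D * r - 4 * \<bar>A\<bar>"
    have "(4 * \<bar>real_of_int B\<bar> * norm s)\<^sup>2 = of_int (16 * B\<^sup>2 * \<bar>d\<bar>)"
      by (simp add: power_mult_distrib s_norm)
    also have "\<dots> \<le> of_int (m\<^sup>2)" using r(3) unfolding m_def of_int_le_iff .
    finally have "(4 * \<bar>real_of_int B\<bar> * norm s)\<^sup>2 \<le> (of_int m)\<^sup>2" by simp
    moreover have "0 \<le> m" using r(2) by (simp add: m_def)
    then have "0 \<le> real_of_int m" by simp
    ultimately have Bs: "4 * \<bar>real_of_int B\<bar> * norm s \<le> of_int m"
      by (rule power2_le_imp_le)
    have "of_int D ^ 2 * t = of_int A + of_int B * s \<or> of_int D ^ 2 * t = of_int A - of_int B * s"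
      using t D by (auto simp: c_def sqrt_span_def of_rat_divide of_rat_power field_simps)
    moreover have "4 * of_int D ^ 2 * t = 4 * (of_int D ^ 2 * t)" by simp
    ultimately have "4 * of_int D ^ 2 * t = of_int (4 * A) + of_int (4 * B) * s \<or>
          4 * of_int D ^ 2 * t = of_int (4 * A) - of_int (4 * B) * s"
      by (elim disjE) (simp_all add: distrib_left right_diff_distrib)
    then have "norm (4 * of_int D ^ 2 * t) \<le> norm (of_int (4 * A) :: complex) + norm (of_int (4 * B) * s)"
      using norm_triangle_ineq[of "of_int (4 * A)" "of_int (4 * B) * s"]
        norm_triangle_ineq4[of "of_int (4 * A)" "of_int (4 * B) * s"] by (elim disjE) (simp_all only:)
    then have "4 * of_int D ^ 2 * norm t \<le> 4 * \<bar>real_of_int A\<bar> + 4 * \<bar>real_of_int B\<bar> * norm s"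
      using D by (simp add: norm_mult norm_power abs_mult)
    also have "\<dots> \<le> of_int (4 * \<bar>A\<bar> + m)" using Bs by simp
    also have "\<dots> = of_int r ^ 2 - 2 * of_int D * of_int r" by (simp add: m_def)
    also have "\<dots> = 4 * of_int D ^ 2 * (b\<^sup>2 - b)"
      using D by (simp add: b_def field_simps power2_eq_square)
    finally show ?thesis using D by simp
  qed
  then have "norm (sqrt_span s p) \<le> b" "norm (sqrt_span (- s) p) \<le> b"
    using preperiodic_norm_le[OF b1] pre preperiodic_conj_iff by blast+
  then have "(norm (sqrt_span s p))\<^sup>2 + (norm (sqrt_span (- s) p))\<^sup>2 \<le> b\<^sup>2 + b\<^sup>2"
    by (intro add_mono power_mono) auto
  then have "(of_rat (fst p))\<^sup>2 + of_int \<bar>d\<bar> * (of_rat (snd p))\<^sup>2 \<le> b\<^sup>2"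
    using norm_sqrt_span_square_sum[of "fst p" "snd p"] by simp
  then have "(real_of_int u / of_int (2 * D))\<^sup>2 + of_int \<bar>d\<bar> * (real_of_int v / of_int (2 * D))\<^sup>2
      \<le> (of_int r / of_int (2 * D))\<^sup>2"
    by (simp add: p b_def of_rat_divide of_rat_mult)
  then have "real_of_int (u\<^sup>2 + \<bar>d\<bar> * v\<^sup>2) \<le> of_int (r\<^sup>2)"
    using D by (simp add: power_divide field_simps)
  then have "u\<^sup>2 + \<bar>d\<bar> * v\<^sup>2 \<le> r\<^sup>2" by (simp only: of_int_le_iff)
  then show ?thesis using p by blast
qed

section \<open>Certified preperiodic graphs\<close>

lemma squarefree_test:
  fixes d n :: int
  assumes "d \<noteq> 0" "0 < n" "\<bar>d\<bar> < n * n" "\<And>q. 2 \<le> q \<Longrightarrow> q < n \<Longrightarrow> d mod (q * q) \<noteq> 0"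
  shows "squarefree d"
  unfolding squarefree_def
proof (intro allI impI)
  fix x assume x: "x\<^sup>2 dvd d"
  then have "x\<^sup>2 \<le> \<bar>d\<bar>" using dvd_imp_le_int[OF assms(1) x] by simp
  then have "\<bar>x\<bar>\<^sup>2 < n\<^sup>2" using assms(3) by (simp add: power2_eq_square)
  then have "\<bar>x\<bar> < n" by (rule power2_less_imp_less) (use assms(2) in simp)
  moreover have "d mod (\<bar>x\<bar> * \<bar>x\<bar>) = 0"
    using x by (simp add: power2_eq_square)
  ultimately have "\<not> 2 \<le> \<bar>x\<bar>" using assms(4)[of "\<bar>x\<bar>"] by auto
  moreover have "x \<noteq> 0" using x assms(1) by auto
  ultimately have "\<bar>x\<bar> = 1" by linarith
  then show "x dvd 1" by auto
qed

text \<open>The pair \<open>(u, v)\<close> stands for the point \<open>(u + v \<surd>d) / (2D)\<close> and \<open>(A, B)\<close> for the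
  parameter \<open>c = (A + B \<surd>d) / D\<^sup>2\<close> of the map \<open>z\<^sup>2 + c\<close>. A point escapes if some iterate leaves the
  lattice of such points or the ellipse \<open>u\<^sup>2 + \<bar>d\<bar> v\<^sup>2 \<le> r\<^sup>2\<close>.\<close>

fun escapes :: "int \<Rightarrow> int \<Rightarrow> int \<Rightarrow> int \<Rightarrow> int \<Rightarrow> nat \<Rightarrow> int \<times> int \<Rightarrow> bool" where
  "escapes d D A B r 0 (u, v) \<longleftrightarrow> r * r < u * u + \<bar>d\<bar> * (v * v)"
| "escapes d D A B r (Suc n) (u, v) \<longleftrightarrow> r * r < u * u + \<bar>d\<bar> * (v * v) \<or>
     (let x = u * u + d * (v * v) + 4 * A; y = 2 * u * v + 4 * B
      in x mod (2 * D) \<noteq> 0 \<or> y mod (2 * D) \<noteq> 0 \<or>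
         escapes d D A B r n (x div (2 * D), y div (2 * D)))"

section \<open>Exact arithmetic on the candidate points\<close>

locale quadratic_map = quadratic_root +
  fixes D A B r :: int
  assumes D_pos: "D > 0" and r_ge: "2 * D \<le> r" "4 * \<bar>A\<bar> \<le> r\<^sup>2 - 2 * D * r"
      "16 * B\<^sup>2 * \<bar>d\<bar> \<le> (r\<^sup>2 - 2 * D * r - 4 * \<bar>A\<bar>)\<^sup>2"
begin

definition param :: complex where
  "param = sqrt_span s (of_int A / of_int D ^ 2, of_int B / of_int D ^ 2)"

definition point :: "int \<times> int \<Rightarrow> complex" where
  "point p = sqrt_span s (of_int (fst p) / of_int (2 * D), of_int (snd p) / of_int (2 * D))"

lemma point_eq_iff: "point p = point q \<longleftrightarrow> p = q"
  using D_pos by (auto simp: point_def sqrt_span_eq_iff prod_eq_iff)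

text \<open>Both sides are put over the denominator \<open>4 * D^2\<close> and their coordinates
  compared. This yields the integer equations that the certificates test.\<close>

lemma point_step_iff:
  "(point (u, v))\<^sup>2 + param = point (u', v') \<longleftrightarrow>
     u * u + d * (v * v) + 4 * A = 2 * D * u' \<and> 2 * u * v + 4 * B = 2 * D * v'"
proof -
  define p c q :: "rat \<times> rat" where
    "p = (of_int u / of_int (2 * D), of_int v / of_int (2 * D))" and
    "c = (of_int A / of_int D ^ 2, of_int B / of_int D ^ 2)" and
    "q = (of_int u' / of_int (2 * D), of_int v' / of_int (2 * D))"
  have "(point (u, v))\<^sup>2 + param = point (u', v') \<longleftrightarrow> pair_mult d p p + c = q"
    by (simp add: point_def param_def p_def c_def q_def power2_eq_square
        sqrt_span_pair_mult[OF s_square, symmetric] sqrt_span_add[symmetric] sqrt_span_eq_iff)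
  also have "pair_mult d p p + c = (rat_of_int (u * u + d * (v * v) + 4 * A) / (4 * of_int D ^ 2),
      rat_of_int (2 * u * v + 4 * B) / (4 * of_int D ^ 2))"
    using D_pos by (simp add: pair_mult_def p_def c_def field_simps power2_eq_square)
  also have "q = (rat_of_int (2 * D * u') / (4 * of_int D ^ 2), rat_of_int (2 * D * v') / (4 * of_int D ^ 2))"
    using D_pos by (simp add: q_def field_simps power2_eq_square)
  also have "(rat_of_int (u * u + d * (v * v) + 4 * A) / (4 * of_int D ^ 2),
      rat_of_int (2 * u * v + 4 * B) / (4 * of_int D ^ 2)) =
      (rat_of_int (2 * D * u') / (4 * of_int D ^ 2), rat_of_int (2 * D * v') / (4 * of_int D ^ 2)) \<longleftrightarrow>
      rat_of_int (u * u + d * (v * v) + 4 * A) = of_int (2 * D * u') \<and>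
      rat_of_int (2 * u * v + 4 * B) = of_int (2 * D * v')"
    unfolding prod.inject using D_pos by (subst (1 2) divide_cancel_right) simp
  finally show ?thesis by (simp only: of_int_eq_iff)
qed

lemma preperiodic_point:
  assumes "z \<in> range (sqrt_span s)" "preperiodic (\<lambda>z. z\<^sup>2 + param) z"
  shows "\<exists>u v. z = point (u, v) \<and> u * u + \<bar>d\<bar> * (v * v) \<le> r * r"
proof -
  obtain p where p: "z = sqrt_span s p" using assms(1) by blast
  from preperiodic_bound[OF D_pos r_ge assms(2)[unfolded p param_def]]
  show ?thesis by (auto simp: p point_def power2_eq_square)
qed

text \<open>Iterates of a preperiodic point are preperiodic, so they stay in the lattice and in the
  ellipse. A point surviving \<open>n\<close> steps is not thereby preperiodic; that direction is
  left to the closed list in the certificate.\<close>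

lemma preperiodic_not_escapes:
  "preperiodic (\<lambda>z. z\<^sup>2 + param) (point p) \<Longrightarrow> \<not> escapes d D A B r n p"
proof (induction n arbitrary: p)
  case (0 p)
  have "point p \<in> range (sqrt_span s)" by (simp add: point_def)
  with preperiodic_point 0 show ?case
    by (cases p) (force simp: point_eq_iff)
next
  case (Suc n p)
  obtain u v where p: "p = (u, v)" by (cases p)
  have in_range: "point p \<in> range (sqrt_span s)" for p by (simp add: point_def)
  have box: "u * u + \<bar>d\<bar> * (v * v) \<le> r * r"
    using preperiodic_point[OF in_range Suc.prems] by (auto simp: point_eq_iff p)
  have pre: "preperiodic (\<lambda>z. z\<^sup>2 + param) ((point p)\<^sup>2 + param)"
    using preperiodic_step[OF Suc.prems] .
  have "(point p)\<^sup>2 + param \<in> range (sqrt_span s)"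
    by (simp add: point_def param_def power2_eq_square
        sqrt_span_pair_mult[OF s_square, symmetric] sqrt_span_add[symmetric])
  from preperiodic_point[OF this pre] obtain u' v' where
    uv': "(point (u, v))\<^sup>2 + param = point (u', v')" by (auto simp: p)
  then have "\<not> escapes d D A B r n (u', v')" using Suc.IH pre by (simp add: p)
  \<comment> \<open>The image is a lattice point, so both remainders vanish and the divisions in
    \<open>escapes\<close> are exact.\<close>
  then show ?case
    using uv' box D_pos unfolding p point_step_iff by simp
qed

end

text \<open>\<open>g\<close> lists the positions in \<open>S\<close> of the images of the points of \<open>S\<close>. In \<open>g @ [length g]\<close> the last
  entry stands for the fixed point \<open>\<infinity>\<close>.\<close>

definition certified ::
    "int \<Rightarrow> int \<Rightarrow> int \<Rightarrow> int \<Rightarrow> int \<Rightarrow> int \<Rightarrow> (int \<times> int) list \<Rightarrow> nat list \<Rightarrow> bool" where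
  "certified d D A B r V S g \<longleftrightarrow>
     d \<noteq> 0 \<and> d \<noteq> 1 \<and> \<bar>d\<bar> < 400 \<and> list_all (\<lambda>q. d mod (q * q) \<noteq> 0) [2..19] \<and>
     0 < D \<and> 2 * D \<le> r \<and> 4 * \<bar>A\<bar> \<le> r * r - 2 * D * r \<and>
     16 * (B * B) * \<bar>d\<bar> \<le> (r * r - 2 * D * r - 4 * \<bar>A\<bar>) * (r * r - 2 * D * r - 4 * \<bar>A\<bar>) \<and>
     0 \<le> V \<and> r * r < \<bar>d\<bar> * ((V + 1) * (V + 1)) \<and>
     distinct S \<and> length g = length S \<and>
     list_all (\<lambda>((u, v), j). j < length S \<and>
       u * u + d * (v * v) + 4 * A = 2 * D * fst (S ! j) \<and> 2 * u * v + 4 * B = 2 * D * snd (S ! j)) (zip S g) \<and>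
     list_all (\<lambda>v. list_all (\<lambda>u. escapes d D A B r 3 (u, v) \<or> (u, v) \<in> set S) [-r..r]) [-V..V]"

definition example_field :: "int \<Rightarrow> complex set" where
  "example_field d = range (sqrt_span (csqrt (of_int d)))"

definition example_poly :: "int \<Rightarrow> int \<Rightarrow> int \<Rightarrow> int \<Rightarrow> complex poly" where
  "example_poly d D A B =
     [:sqrt_span (csqrt (of_int d)) (of_int A / of_int D ^ 2, of_int B / of_int D ^ 2), 0, 1:]"

section \<open>An isomorphism invariant\<close>

definition pair_count :: "'a set \<Rightarrow> ('a \<Rightarrow> 'a) \<Rightarrow> nat \<times> nat \<times> nat \<times> nat \<Rightarrow> nat" where
  "pair_count V F = (\<lambda>(i, j, k, l).
     card {(x, y). x \<in> V \<and> y \<in> V \<and> (F ^^ i) x = (F ^^ j) y \<and> (F ^^ k) x = (F ^^ l) x})"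

text \<open>Serves twice: to number the actual vertices by list positions, and to compare isomorphic
  graphs.\<close>

lemma pair_count_conjugate:
  assumes bij: "bij_betw \<phi> V V'" and closed: "\<And>x. x \<in> V \<Longrightarrow> F x \<in> V"
    and conj: "\<And>x. x \<in> V \<Longrightarrow> F' (\<phi> x) = \<phi> (F x)"
  shows "pair_count V' F' t = pair_count V F t"
proof -
  obtain i j k l where t: "t = (i, j, k, l)" by (cases t)
  have iter: "(F ^^ n) x \<in> V \<and> (F' ^^ n) (\<phi> x) = \<phi> ((F ^^ n) x)" if "x \<in> V" for n x
    using that by (induction n) (auto simp: closed conj)
  have inj: "\<phi> x = \<phi> y \<longleftrightarrow> x = y" if "x \<in> V" "y \<in> V" for x y
    using bij that by (auto simp: bij_betw_def inj_on_def)
  let ?P = "{(x, y). x \<in> V \<and> y \<in> V \<and> (F ^^ i) x = (F ^^ j) y \<and> (F ^^ k) x = (F ^^ l) x}"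
  let ?P' = "{(x, y). x \<in> V' \<and> y \<in> V' \<and> (F' ^^ i) x = (F' ^^ j) y \<and> (F' ^^ k) x = (F' ^^ l) x}"
  have "inj_on (map_prod \<phi> \<phi>) ?P"
    by (auto simp: inj_on_def inj)
  then have card: "card (map_prod \<phi> \<phi> ` ?P) = card ?P" by (rule card_image)
  have "map_prod \<phi> \<phi> ` ?P = ?P'"
  proof (intro equalityI subsetI)
    fix w assume "w \<in> map_prod \<phi> \<phi> ` ?P"
    then obtain x y where xy: "w = (\<phi> x, \<phi> y)" "(x, y) \<in> ?P" by auto
    then have "\<phi> x \<in> V'" "\<phi> y \<in> V'" using bij by (auto simp: bij_betw_def)
    with xy show "w \<in> ?P'" by (simp add: iter)
  next
    fix w assume w: "w \<in> ?P'"
    then obtain x y where xy: "w = (\<phi> x, \<phi> y)" "x \<in> V" "y \<in> V"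
      using bij by (auto simp: bij_betw_def)
    with w have "(x, y) \<in> ?P" by (simp add: iter inj)
    with xy(1) show "w \<in> map_prod \<phi> \<phi> ` ?P" by (auto intro!: image_eqI[of _ _ "(x, y)"])
  qed
  with card show ?thesis unfolding pair_count_def t prod.case by (simp only:)
qed

fun iterates :: "nat list \<Rightarrow> nat \<Rightarrow> nat list" where
  "iterates h 0 = [0..<length h]"
| "iterates h (Suc k) = map ((!) h) (iterates h k)"

fun pair_count_list :: "nat list \<Rightarrow> nat \<times> nat \<times> nat \<times> nat \<Rightarrow> nat" where
  "pair_count_list h (i, j, k, l) =
     (let ys = iterates h j in
      sum_list (map (\<lambda>(a, b, c). if b = c then count_list ys a else 0)
        (zip (iterates h i) (zip (iterates h k) (iterates h l)))))"

lemma iterates_eq: "iterates h k = map ((!) h ^^ k) [0..<length h]"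
  by (induction k) (simp_all add: map_idI)

lemma pair_count_list_eq: "pair_count_list h t = pair_count {..<length h} ((!) h) t"
proof -
  obtain i j k l where t: "t = (i, j, k, l)" by (cases t)
  define F where "F = (!) h"
  define n where "n = length h"
  define Y where "Y x = {y. y < n \<and> (F ^^ i) x = (F ^^ j) y}" for x
  have zip3: "zip (map f xs) (zip (map f' xs) (map f'' xs)) = map (\<lambda>x. (f x, f' x, f'' x)) xs"
    for f f' f'' :: "nat \<Rightarrow> nat" and xs
    by (induction xs) auto
  have count: "count_list (map (F ^^ j) [0..<n]) ((F ^^ i) x) = card (Y x)" for x
  proof -
    have "count_list (map (F ^^ j) [0..<n]) ((F ^^ i) x) =
        length (filter (\<lambda>y. (F ^^ i) x = (F ^^ j) y) [0..<n])"
      by (simp add: count_list_eq_length_filter filter_map comp_def)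
    also have "\<dots> = card {y. y < length [0..<n] \<and> (F ^^ i) x = (F ^^ j) ([0..<n] ! y)}"
      by (rule length_filter_conv_card)
    also have "{y. y < length [0..<n] \<and> (F ^^ i) x = (F ^^ j) ([0..<n] ! y)} = Y x"
      by (auto simp: Y_def)
    finally show ?thesis .
  qed
  have "pair_count_list h t = (\<Sum>x<n. if (F ^^ k) x = (F ^^ l) x then card (Y x) else 0)"
    by (simp add: t iterates_eq zip3 comp_def count F_def[symmetric] n_def[symmetric]
        interv_sum_list_conv_sum_set_nat atLeast0LessThan cong: if_cong)
  also have "\<dots> = (\<Sum>x \<in> {x \<in> {..<n}. (F ^^ k) x = (F ^^ l) x}. card (Y x))"
    by (rule sum.inter_filter[symmetric]) simp
  also have "\<dots> = card (SIGMA x : {x \<in> {..<n}. (F ^^ k) x = (F ^^ l) x}. Y x)"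
    by (rule card_SigmaI[symmetric]) (simp_all add: Y_def)
  also have "(SIGMA x : {x \<in> {..<n}. (F ^^ k) x = (F ^^ l) x}. Y x) =
      {(x, y). x \<in> {..<n} \<and> y \<in> {..<n} \<and> (F ^^ i) x = (F ^^ j) y \<and> (F ^^ k) x = (F ^^ l) x}"
    by (auto simp: Y_def)
  finally show ?thesis by (simp add: pair_count_def t F_def n_def)
qed

section \<open>From certificates to preperiodic graphs\<close>

lemma example_structure:
  assumes "certified d D A B r V S g"
  shows "quadratic_field (example_field d)"
    and "quadratic_poly_over (example_field d) (example_poly d D A B)"
    and "card (PrePer (example_poly d D A B) (example_field d)) = Suc (length S)"
    and "pair_count (PrePer (example_poly d D A B) (example_field d)) (proj_map (example_poly d D A B)) t
           = pair_count_list (g @ [length g]) t"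
proof -
  let ?s = "csqrt (of_int d)"
  have d: "d \<noteq> 0" "d \<noteq> 1" "\<bar>d\<bar> < 400" "\<forall>q \<in> set [2..19]. d mod (q * q) \<noteq> 0"
    and D: "0 < D" "2 * D \<le> r" "4 * \<bar>A\<bar> \<le> r * r - 2 * D * r"
      "16 * (B * B) * \<bar>d\<bar> \<le> (r * r - 2 * D * r - 4 * \<bar>A\<bar>) * (r * r - 2 * D * r - 4 * \<bar>A\<bar>)"
    and V: "0 \<le> V" "r * r < \<bar>d\<bar> * ((V + 1) * (V + 1))"
    and S: "distinct S" and len: "length g = length S"
    and edges: "\<forall>((u, v), j) \<in> set (zip S g). j < length S \<and>
       u * u + d * (v * v) + 4 * A = 2 * D * fst (S ! j) \<and> 2 * u * v + 4 * B = 2 * D * snd (S ! j)"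
    and esc: "\<forall>v \<in> set [-V..V]. \<forall>u \<in> set [-r..r]. escapes d D A B r 3 (u, v) \<or> (u, v) \<in> set S"
    using assms unfolding certified_def list_all_iff by - (elim conjE, assumption)+
  have "squarefree d"
  \<comment> \<open>Since \<open>\<bar>d\<bar> < 400 = 20 * 20\<close>, the square divisors to
    exclude are those of 2 to 19.\<close>
  proof (rule squarefree_test[of d 20])
    fix q :: int assume "2 \<le> q" "q < 20"
    then have "q \<in> set [2..19]" by (simp only: set_upto atLeastAtMost_iff) simp
    then show "d mod (q * q) \<noteq> 0" by (rule d(4)[rule_format])
  qed (use d in simp_all)
  then interpret quadratic_map d ?s D A B r
    using d(2) D power2_csqrt by unfold_locales (simp_all only: power2_eq_square not_False_eq_True)
  let ?K = "example_field d"
  let ?f = "example_poly d D A B"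
  have f: "?f = [:param, 0, 1:]" by (simp add: example_poly_def param_def)
  have K: "?K = range (sqrt_span ?s)" by (simp add: example_field_def)
  show "quadratic_field ?K" unfolding K by (rule quadratic_field_range_sqrt_span)
  have "0 = sqrt_span ?s (0, 0)" "1 = sqrt_span ?s (1, 0)" by (simp_all add: sqrt_span_def)
  then have "0 \<in> ?K" "1 \<in> ?K" "param \<in> ?K" by (auto simp: K param_def)
  then show "quadratic_poly_over ?K ?f"
    by (auto simp: quadratic_poly_over_def f coeff_pCons split: nat.split)
  have f_Some: "proj_map ?f (Some z) = Some (z\<^sup>2 + param)" for z
    by (simp add: proj_map_def f power2_eq_square add.commute)
  have pre_Some: "preperiodic (proj_map ?f) (Some z) \<longleftrightarrow> preperiodic (\<lambda>z. z\<^sup>2 + param) z" for z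
    by (rule preperiodic_conjugate) (simp_all add: f_Some)
  have closed: "g ! i < length S \<and> (point (S ! i))\<^sup>2 + param = point (S ! (g ! i))" if "i < length S" for i
  proof -
    obtain u v where uv: "S ! i = (u, v)" by (cases "S ! i")
    have "((u, v), g ! i) \<in> set (zip S g)" using that len uv by (auto simp: set_zip intro!: exI[of _ i])
    then have "g ! i < length S" "u * u + d * (v * v) + 4 * A = 2 * D * fst (S ! (g ! i))"
        "2 * u * v + 4 * B = 2 * D * snd (S ! (g ! i))"
      using edges by auto
    then show ?thesis using point_step_iff[of u v "fst (S ! (g ! i))" "snd (S ! (g ! i))"] by (simp add: uv)
  qed
  \<comment> \<open>One inclusion is the closedness of the finite list, the other the exhaustive
    scan of the box.\<close>
  have iff: "z \<in> ?K \<and> preperiodic (\<lambda>z. z\<^sup>2 + param) z \<longleftrightarrow> z \<in> point ` set S" for z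
  proof
    assume "z \<in> point ` set S"
    moreover have "w\<^sup>2 + param \<in> point ` set S" if "w \<in> point ` set S" for w
    proof -
      obtain i where "i < length S" "w = point (S ! i)" using \<open>w \<in> point ` set S\<close> by (auto simp: in_set_conv_nth)
      then show ?thesis using closed[of i] by simp
    qed
    ultimately have "preperiodic (\<lambda>z. z\<^sup>2 + param) z"
      by (intro preperiodic_closed[of "point ` set S"]) auto
    then show "z \<in> ?K \<and> preperiodic (\<lambda>z. z\<^sup>2 + param) z"
      using \<open>z \<in> point ` set S\<close> by (auto simp: K point_def)
  next
    assume z: "z \<in> ?K \<and> preperiodic (\<lambda>z. z\<^sup>2 + param) z"
    then obtain u v where uv: "z = point (u, v)" "u * u + \<bar>d\<bar> * (v * v) \<le> r * r"
      using preperiodic_point[of z] unfolding K by blast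
    have "0 \<le> r" using D by linarith
    have "0 \<le> \<bar>d\<bar> * (v * v)" by simp
    then have "u\<^sup>2 \<le> r\<^sup>2" using uv(2) unfolding power2_eq_square by linarith
    then have "\<bar>u\<bar> \<le> r" using \<open>0 \<le> r\<close> abs_le_square_iff[of u r] by simp
    \<comment> \<open>Beyond \<open>V\<close> the term \<open>\<bar>d\<bar> * v^2\<close> alone
      exceeds \<open>r^2\<close>, so the scanned rectangle contains the ellipse.\<close>
    have "\<bar>d\<bar> * (v * v) < \<bar>d\<bar> * ((V + 1) * (V + 1))"
      using uv(2) zero_le_square[of u] V(2) by linarith
    then have "v * v < (V + 1) * (V + 1)" by (rule mult_left_less_imp_less) simp
    then have "v\<^sup>2 < (V + 1)\<^sup>2" by (simp only: power2_eq_square)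
    then have "\<bar>v\<bar>\<^sup>2 < (V + 1)\<^sup>2" by simp
    then have "\<bar>v\<bar> < V + 1" by (rule power2_less_imp_less) (use V(1) in simp)
    then have "v \<in> set [-V..V]" "u \<in> set [-r..r]" using \<open>\<bar>u\<bar> \<le> r\<close> by auto
    then have "escapes d D A B r 3 (u, v) \<or> (u, v) \<in> set S" using esc by blast
    moreover have "\<not> escapes d D A B r 3 (u, v)"
      using z uv(1) preperiodic_not_escapes by blast
    ultimately show "z \<in> point ` set S" using uv(1) by blast
  qed
  \<comment> \<open>Infinity takes position \<open>length S\<close>, where the last entry of
    \<open>h\<close> is a loop.\<close>
  define vs where "vs = map (Some \<circ> point) S @ [None]"
  define h where "h = g @ [length g]"
  have "preperiodic (proj_map ?f) None"
    by (rule preperiodic_closed[of "{None}"]) (auto simp: proj_map_def)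
  then have P: "PrePer ?f ?K = set vs"
    using iff by (fastforce simp: PrePer_def proj_line_def vs_def pre_Some)
  have "distinct vs"
    using S by (auto simp: vs_def distinct_map inj_on_def point_eq_iff)
  then show "card (PrePer ?f ?K) = Suc (length S)"
    by (simp add: P distinct_card) (simp add: vs_def)
  have "pair_count (set vs) (proj_map ?f) t = pair_count {..<length h} ((!) h) t"
  proof (rule pair_count_conjugate)
    show "bij_betw ((!) vs) {..<length h} (set vs)"
      using \<open>distinct vs\<close> len by (intro bij_betw_nth) (simp_all add: vs_def h_def)
    fix i assume "i \<in> {..<length h}"
    then consider "i < length S" | "i = length S" by (auto simp: h_def len less_Suc_eq)
    then have "h ! i < length h \<and> proj_map ?f (vs ! i) = vs ! (h ! i)"
    proof cases
      case 1
      then show ?thesis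
        using closed[OF 1] len by (simp add: h_def vs_def nth_append f_Some)
    next
      case 2
      then show ?thesis by (simp add: h_def vs_def nth_append len proj_map_def)
    qed
    then show "h ! i \<in> {..<length h}" "proj_map ?f (vs ! i) = vs ! (h ! i)" by auto
  qed
  then show "pair_count (PrePer ?f ?K) (proj_map ?f) t = pair_count_list (g @ [length g]) t"
    by (simp add: P pair_count_list_eq h_def)
qed

text \<open>An isomorphism moves vertices and arcs separately and brings its own tail and head maps.
  In the target these are \<open>fst\<close> and \<open>snd\<close>, and every arc there has the
  form \<open>(P, proj_map f' P)\<close>; this forces the vertex map to commute with the
  dynamics.\<close>

lemma digraph_iso_pair_count:
  assumes "digraph_iso (preper_graph f K) (preper_graph f' K')"
    and closed: "\<And>P. P \<in> PrePer f K \<Longrightarrow> proj_map f P \<in> PrePer f K"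
  shows "pair_count (PrePer f' K') (proj_map f') t = pair_count (PrePer f K) (proj_map f) t"
proof -
  obtain hom where hom: "pre_digraph.digraph_isomorphism (preper_graph f K) hom"
      "preper_graph f' K' = app_iso hom (preper_graph f K)"
    using assms(1) by (auto simp: digraph_iso_def)
  note iso = hom(1)[unfolded pre_digraph.digraph_isomorphism_def]
  have verts: "PrePer f' K' = iso_verts hom ` PrePer f K"
    and arcs: "{(P, proj_map f' P) | P. P \<in> PrePer f' K'} = iso_arcs hom ` {(P, proj_map f P) | P. P \<in> PrePer f K}"
    and ends: "iso_tail hom = fst" "iso_head hom = snd"
    using arg_cong[OF hom(2), of verts] arg_cong[OF hom(2), of arcs]
      arg_cong[OF hom(2), of tail] arg_cong[OF hom(2), of head]
    by (simp_all only: preper_graph_def app_iso_simps pre_digraph.select_convs)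
  show ?thesis
  proof (rule pair_count_conjugate)
    show "bij_betw (iso_verts hom) (PrePer f K) (PrePer f' K')"
      using iso verts by (auto simp: bij_betw_def preper_graph_def)
    fix P assume P: "P \<in> PrePer f K"
    then show "proj_map f P \<in> PrePer f K" by (rule closed)
    have arc: "(P, proj_map f P) \<in> {(P, proj_map f P) | P. P \<in> PrePer f K}" using P by blast
    then have "iso_verts hom P = fst (iso_arcs hom (P, proj_map f P))"
      "iso_verts hom (proj_map f P) = snd (iso_arcs hom (P, proj_map f P))"
      using iso by (simp_all add: preper_graph_def ends)
    moreover have "iso_arcs hom (P, proj_map f P) \<in> {(P, proj_map f' P) | P. P \<in> PrePer f' K'}"
      unfolding arcs using arc by (rule imageI)
    ultimately show "proj_map f' (iso_verts hom P) = iso_verts hom (proj_map f P)" by auto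
  qed
qed

lemma subring_poly_closed:
  assumes "quadratic_field K" "quadratic_poly_over K f" "z \<in> K"
  shows "poly f z \<in> K"
proof -
  interpret C: ring "ring_of_type_algebra :: complex ring" by (rule ring_from_type_algebra)
  have sub: "subring K (ring_of_type_algebra :: complex ring)"
    using assms(1) by (auto simp: quadratic_field_def dest: subfieldE(1))
  have add: "x + y \<in> K" and mult: "x * y \<in> K" if "x \<in> K" "y \<in> K" for x y
    using subringE(6,7)[OF sub] that by (simp_all add: ring_of_type_algebra_def)
  have coeff: "Polynomial.coeff f i \<in> K" for i using assms(2) by (simp add: quadratic_poly_over_def)
  have "poly f z = Polynomial.coeff f 0 + (Polynomial.coeff f 1 * z + Polynomial.coeff f 2 * (z * z))"
    using assms(2) by (simp add: poly_altdef quadratic_poly_over_def numeral_2_eq_2)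
  then show ?thesis using coeff assms(3) add mult by simp
qed

lemma PrePer_closed:
  assumes "quadratic_field K" "quadratic_poly_over K f" "P \<in> PrePer f K"
  shows "proj_map f P \<in> PrePer f K"
  using assms(3) subring_poly_closed[OF assms(1,2)] preperiodic_step[of "proj_map f" P]
  by (auto simp: PrePer_def proj_line_def proj_map_def)

section \<open>The examples\<close>

text \<open>Each entry is \<open>(d, D, A, B, r, V, S, g)\<close>, ordered by the length of
  \<open>S\<close>; in the first, infinity is the only vertex. All but five parameters are rational.
  Two of the three largest graphs come from -29/16, whose rational 3-cycle runs through -1/4, -7/4,
  5/4.\<close>

definition examples :: "(int \<times> int \<times> int \<times> int \<times> int \<times> int \<times> (int \<times> int) list \<times> nat list) list" where
  "examples =
   [(-5, 1, 1, 0, 4, 1, [], []),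
   (7, 2, 1, 0, 5, 1, [(-2, 0), (2, 0)], [1, 1]),
   (-2, 1, 0, 0, 2, 1, [(-2, 0), (0, 0), (2, 0)], [2, 1, 2]),
   (-5, 1, -1, 0, 4, 1, [(-2, 0), (0, 0), (2, 0)], [1, 0, 1]),
   (-3, 2, 1, 0, 5, 2, [(-2, 0), (2, 0), (0, 2), (0, -2)], [1, 1, 0, 0]),
   (-10, 2, -3, 0, 6, 1, [(-6, 0), (-2, 0), (2, 0), (6, 0)], [3, 1, 1, 3]),
   (7, 1, -3, 0, 5, 1, [(-4, 0), (-2, 0), (2, 0), (4, 0)], [2, 0, 0, 2]),
   (-5, 1, -2, 0, 4, 1, [(-4, 0), (-2, 0), (0, 0), (2, 0), (4, 0)], [4, 1, 0, 1, 4]),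
   (-1, 1, 0, 0, 2, 2, [(-2, 0), (0, 0), (2, 0), (0, 2), (0, -2)], [2, 1, 2, 0, 0]),
   (2, 1, -1, 0, 4, 2, [(-2, 0), (0, 0), (2, 0), (0, 2), (0, -2)], [1, 0, 1, 2, 2]),
   (-1, 1, 0, 1, 4, 4, [(0, 0), (-2, 2), (2, -2), (0, 2), (0, -2)], [3, 4, 4, 1, 1]),
   (2, 1, -2, 1, 5, 3, [(-2, 0), (2, 0), (-2, 2), (2, -2), (0, 2), (0, -2)], [2, 2, 3, 3, 4, 4]),
   (2, 1, -3, 0, 5, 3, [(-4, 0), (-2, 0), (2, 0), (4, 0), (0, 2), (0, -2)], [2, 0, 0, 2, 1, 1]),
   (-1, 2, 1, 0, 5, 5, [(-2, 0), (2, 0), (-2, 4), (2, -4), (2, 4), (-2, -4)], [1, 1, 5, 5, 2, 2]),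
   (5, 4, -34, 2, 18, 8, [(-6, 2), (6, -2), (10, 2), (-10, -2), (-2, 6), (2, -6)], [3, 3, 4, 4, 1, 1]),
   (3, 1, -2, 0, 4, 2, [(-4, 0), (-2, 0), (0, 0), (2, 0), (4, 0), (0, 2), (0, -2)], [4, 1, 0, 1, 4, 3, 3]),
   (2, 1, -2, 0, 4, 2, [(-4, 0), (-2, 0), (0, 0), (2, 0), (4, 0), (0, 2), (0, -2)], [4, 1, 0, 1, 4, 2, 2]),
   (-3, 1, 0, 0, 2, 1, [(-2, 0), (0, 0), (2, 0), (-1, 1), (1, -1), (1, 1), (-1, -1)], [2, 1, 2, 6, 6, 3, 3]),
   (5, 1, -1, 0, 4, 1, [(-2, 0), (0, 0), (2, 0), (-1, 1), (1, -1), (1, 1), (-1, -1)], [1, 0, 1, 4, 4, 5, 5]),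
   (-5, 3, -10, 0, 10, 4, [(-10, 0), (-8, 0), (-4, 0), (4, 0), (8, 0), (10, 0), (0, 2), (0, -2)], [5, 3, 2, 2, 3, 5, 0, 0]),
   (22, 3, -10, 0, 10, 2, [(-10, 0), (-8, 0), (-4, 0), (4, 0), (8, 0), (10, 0), (0, 2), (0, -2)], [5, 3, 2, 2, 3, 5, 4, 4]),
   (10, 3, -13, 0, 11, 3, [(-10, 0), (-8, 0), (-2, 0), (2, 0), (8, 0), (10, 0), (0, 2), (0, -2)], [4, 3, 1, 1, 3, 4, 2, 2]),
   (7, 3, -13, 0, 11, 4, [(-10, 0), (-8, 0), (-2, 0), (2, 0), (8, 0), (10, 0), (0, 4), (0, -4)], [4, 3, 1, 1, 3, 4, 5, 5]),
   (13, 1, -3, 0, 5, 1, [(-4, 0), (-2, 0), (2, 0), (4, 0), (-1, 1), (1, -1), (1, 1), (-1, -1)], [2, 0, 0, 2, 5, 5, 6, 6]),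
   (-65, 4, -29, 0, 16, 1, [(-14, 0), (-10, 0), (-6, 0), (-2, 0), (2, 0), (6, 0), (10, 0), (14, 0)], [6, 3, 1, 0, 0, 1, 3, 6]),
   (70, 12, -418, 0, 55, 6, [(-36, 2), (36, -2), (36, 2), (-36, -2), (-4, 6), (4, -6), (4, 6), (-4, -6)], [7, 7, 4, 4, 1, 1, 2, 2]),
   (5, 1, -2, 0, 4, 1, [(-4, 0), (-2, 0), (0, 0), (2, 0), (4, 0), (-1, 1), (1, -1), (1, 1), (-1, -1)], [4, 1, 0, 1, 4, 8, 8, 5, 5]),
   (-7, 4, 3, 0, 10, 3, [(-6, 0), (-2, 0), (2, 0), (6, 0), (-4, 2), (4, -2), (0, 2), (0, -2), (4, 2), (-4, -2)], [3, 2, 2, 3, 7, 7, 1, 1, 6, 6]),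
   (17, 4, -17, 4, 17, 4, [(-6, 0), (-2, 0), (2, 0), (6, 0), (-8, 2), (8, -2), (-4, 2), (4, -2), (0, 2), (0, -2)], [6, 4, 4, 6, 5, 5, 2, 2, 8, 8]),
   (-7, 4, -9, 4, 14, 5, [(-6, 0), (-2, 0), (2, 0), (6, 0), (-8, 2), (8, -2), (-4, 2), (4, -2), (0, 2), (0, -2)], [8, 6, 6, 8, 9, 9, 0, 0, 4, 4]),
   (13, 3, -10, 0, 10, 2, [(-10, 0), (-8, 0), (-4, 0), (4, 0), (8, 0), (10, 0), (-3, 1), (3, -1), (3, 1), (-3, -1)], [5, 3, 2, 2, 3, 5, 9, 9, 6, 6]),
   (61, 3, -13, 0, 11, 1, [(-10, 0), (-8, 0), (-2, 0), (2, 0), (8, 0), (10, 0), (-3, 1), (3, -1), (3, 1), (-3, -1)], [4, 3, 1, 1, 3, 4, 7, 7, 8, 8]),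
   (57, 4, -29, 0, 16, 2, [(-14, 0), (-10, 0), (-6, 0), (-2, 0), (2, 0), (6, 0), (10, 0), (14, 0), (0, 2), (0, -2)], [6, 3, 1, 0, 0, 1, 3, 6, 7, 7]),
   (41, 4, -29, 0, 16, 2, [(-14, 0), (-10, 0), (-6, 0), (-2, 0), (2, 0), (6, 0), (10, 0), (14, 0), (0, 2), (0, -2)], [6, 3, 1, 0, 0, 1, 3, 6, 5, 5]),
   (337, 12, -301, 0, 49, 2, [(-46, 0), (-38, 0), (-10, 0), (10, 0), (38, 0), (46, 0), (-12, 2), (12, -2), (12, 2), (-12, -2)], [4, 3, 0, 0, 3, 4, 7, 7, 8, 8]),
   (193, 12, -301, 0, 49, 3, [(-46, 0), (-38, 0), (-10, 0), (10, 0), (38, 0), (46, 0), (-12, 2), (12, -2), (12, 2), (-12, -2)], [4, 3, 0, 0, 3, 4, 9, 9, 6, 6]),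
   (2, 4, -30, 0, 16, 11, [(-12, 2), (12, -2), (-4, 2), (4, -2), (4, 2), (-4, -2), (12, 2), (-12, -2), (-4, 6), (4, -6), (4, 6), (-4, -6)], [9, 9, 7, 7, 0, 0, 10, 10, 11, 11, 8, 8]),
   (17, 4, -13, 0, 13, 3, [(-10, 0), (-6, 0), (-2, 0), (2, 0), (6, 0), (10, 0), (-4, 2), (4, -2), (0, 2), (0, -2), (4, 2), (-4, -2)], [4, 2, 1, 1, 2, 4, 7, 7, 3, 3, 10, 10]),
   (-7, 4, -5, 0, 10, 3, [(-10, 0), (-6, 0), (-2, 0), (2, 0), (6, 0), (10, 0), (-4, 2), (4, -2), (0, 2), (0, -2), (4, 2), (-4, -2)], [5, 3, 2, 2, 3, 5, 11, 11, 1, 1, 6, 6]),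
   (73, 12, -301, 0, 49, 5, [(-46, 0), (-38, 0), (-10, 0), (10, 0), (38, 0), (46, 0), (0, 2), (0, -2), (-6, 4), (6, -4), (6, 4), (-6, -4)], [4, 3, 0, 0, 3, 4, 1, 1, 7, 7, 6, 6]),
   (105, 12, -285, 0, 48, 4, [(-24, 2), (24, -2), (-12, 2), (12, -2), (12, 2), (-12, -2), (24, 2), (-24, -2), (-6, 4), (6, -4), (6, 4), (-6, -4)], [11, 11, 7, 7, 0, 0, 8, 8, 1, 1, 6, 6]),
   (-15, 12, -93, 0, 35, 9, [(-24, 2), (24, -2), (-12, 2), (12, -2), (12, 2), (-12, -2), (24, 2), (-24, -2), (-6, 4), (6, -4), (6, 4), (-6, -4)], [9, 9, 5, 5, 2, 2, 10, 10, 7, 7, 0, 0]),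
   (33, 12, -213, 0, 44, 7, [(-24, 2), (24, -2), (-12, 2), (12, -2), (12, 2), (-12, -2), (24, 2), (-24, -2), (-6, 4), (6, -4), (6, 4), (-6, -4)], [11, 11, 7, 7, 0, 0, 8, 8, 5, 5, 2, 2]),
   (17, 4, -21, 0, 14, 3, [(-14, 0), (-10, 0), (-6, 0), (-2, 0), (2, 0), (6, 0), (10, 0), (14, 0), (-4, 2), (4, -2), (0, 2), (0, -2), (4, 2), (-4, -2)], [7, 4, 2, 1, 1, 2, 4, 7, 11, 11, 3, 3, 10, 10]),
   (33, 4, -29, 0, 16, 2, [(-14, 0), (-10, 0), (-6, 0), (-2, 0), (2, 0), (6, 0), (10, 0), (14, 0), (-4, 2), (4, -2), (0, 2), (0, -2), (4, 2), (-4, -2)], [6, 3, 1, 0, 0, 1, 3, 6, 9, 9, 4, 4, 12, 12]),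
   (17, 4, -29, 0, 16, 3, [(-14, 0), (-10, 0), (-6, 0), (-2, 0), (2, 0), (6, 0), (10, 0), (14, 0), (-4, 2), (4, -2), (0, 2), (0, -2), (4, 2), (-4, -2)], [6, 3, 1, 0, 0, 1, 3, 6, 13, 13, 2, 2, 8, 8])]"

text \<open>In each of the boxes three iterations already expel every lattice point outside
  \<open>S\<close>, so the scan is short.\<close>

lemma examples_certified: "list_all (\<lambda>(d, D, A, B, r, V, S, g). certified d D A B r V S g) examples"
  by code_simp

text \<open>The triple counts the points fixed by the third iterate, the pairs with
  \<open>F^2 x = F^3 y\<close>, and the pairs with \<open>F x = F^2 y\<close> where
  \<open>F x\<close> is fixed by the second iterate. The appended entry is infinity.\<close>

definition fingerprint :: "nat list \<Rightarrow> nat list" where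
  "fingerprint g = map (pair_count_list (g @ [length g])) [(0, 0, 0, 3), (2, 3, 0, 0), (1, 2, 1, 3)]"

lemma examples_fingerprints: "distinct (map (\<lambda>(d, D, A, B, r, V, S, g). fingerprint g) examples)"
  by code_simp

lemma examples_lengths: "length examples = 46"
    "list_ex (\<lambda>(d, D, A, B, r, V, S, g). length S = 14) examples"
  by code_simp+

section \<open>Counting isomorphism classes\<close>

lemma wf_digraph_preper_graph:
  assumes "quadratic_field K" "quadratic_poly_over K f"
  shows "wf_digraph (preper_graph f K)"
  using PrePer_closed[OF assms] by unfold_locales (auto simp: preper_graph_def)

lemma digraph_iso_reflI:
  assumes "wf_digraph G"
  shows "digraph_iso G G"
  unfolding digraph_iso_def
proof (intro exI conjI)
  let ?hom = "\<lparr>iso_verts = id, iso_arcs = id, iso_head = head G, iso_tail = tail G\<rparr>"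
  show "pre_digraph.digraph_isomorphism G ?hom"
    using assms by (simp add: pre_digraph.digraph_isomorphism_def)
  show "G = app_iso ?hom G" by (simp add: app_iso_def)
qed

fun example_graph ::
    "int \<times> int \<times> int \<times> int \<times> int \<times> int \<times> (int \<times> int) list \<times> nat list
      \<Rightarrow> (complex option, complex option \<times> complex option) pre_digraph" where
  "example_graph (d, D, A, B, r, V, S, g) = preper_graph (example_poly d D A B) (example_field d)"

lemma example_graph_quadratic:
  assumes "e \<in> set examples"
  shows "\<exists>K f. quadratic_field K \<and> quadratic_poly_over K f \<and> example_graph e = preper_graph f K"
proof -
  obtain d D A B r V S g where e: "e = (d, D, A, B, r, V, S, g)" by (cases e) auto
  have "certified d D A B r V S g"
    using assms examples_certified by (auto simp: list_all_iff e)
  from example_structure(1,2)[OF this] show ?thesis by (auto simp: e)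
qed

lemma example_graph_iso_imp_eq:
  assumes "e \<in> set examples" "e' \<in> set examples" "digraph_iso (example_graph e) (example_graph e')"
  shows "e = e'"
proof -
  obtain d D A B r V S g where e: "e = (d, D, A, B, r, V, S, g)" by (cases e) auto
  obtain d' D' A' B' r' V' S' g' where e': "e' = (d', D', A', B', r', V', S', g')" by (cases e') auto
  have cert: "certified d D A B r V S g" "certified d' D' A' B' r' V' S' g'"
    using assms(1,2) examples_certified by (auto simp: list_all_iff e e')
  note closed = PrePer_closed[OF example_structure(1,2)[OF cert(1)]]
  have "pair_count_list (g @ [length g]) t = pair_count_list (g' @ [length g']) t" for t
    using digraph_iso_pair_count[OF assms(3)[unfolded e e' example_graph.simps] closed]
    unfolding example_structure(4)[OF cert(1)] example_structure(4)[OF cert(2)] by (rule sym)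
  then have "pair_count_list (g @ [length g]) = pair_count_list (g' @ [length g'])" by (rule ext)
  then have "fingerprint g = fingerprint g'" by (simp only: fingerprint_def)
  have "inj_on (\<lambda>(d, D, A, B, r, V, S, g). fingerprint g) (set examples)"
    using examples_fingerprints by (simp only: distinct_map)
  then show "e = e'" by (rule inj_onD) (use assms(1,2) \<open>fingerprint g = fingerprint g'\<close> in \<open>simp_all only: e e' prod.case\<close>)
qed

theorem theorem1p2:
  shows "(\<forall>N::nat.
            (\<forall>K f. quadratic_field K \<longrightarrow> quadratic_poly_over K f \<longrightarrow>
                 finite (PrePer f K) \<and> card (PrePer f K) \<le> N)
            \<longrightarrow> N \<ge> 15)
       \<and> (\<exists>\<G> :: (complex option, complex option \<times> complex option) pre_digraph set.
            card \<G> \<ge> 46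
          \<and> (\<forall>G\<in>\<G>. \<exists>K f. quadratic_field K \<and> quadratic_poly_over K f \<and> G = preper_graph f K)
          \<and> pairwise (\<lambda>G H. \<not> digraph_iso G H) \<G>)"
proof (intro conjI allI impI)
  fix N :: nat
  assume N: "\<forall>K f. quadratic_field K \<longrightarrow> quadratic_poly_over K f \<longrightarrow>
      finite (PrePer f K) \<and> card (PrePer f K) \<le> N"
  obtain d D A B r V S g where "(d, D, A, B, r, V, S, g) \<in> set examples" "length S = 14"
    using examples_lengths(2) by (auto simp: list_ex_iff)
  moreover from this(1) have cert: "certified d D A B r V S g"
    using examples_certified by (auto simp: list_all_iff)
  ultimately have "card (PrePer (example_poly d D A B) (example_field d)) = 15"
    using example_structure(3)[OF cert] by simp
  then show "N \<ge> 15" using N example_structure(1,2)[OF cert] by metis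
next
  \<comment> \<open>\<open>pairwise\<close> compares only distinct members, so it cannot rule out
    that entries share a graph. Reflexivity does: equal graphs are isomorphic, hence come from the
    same entry.\<close>
  have refl: "digraph_iso (example_graph e) (example_graph e)" if "e \<in> set examples" for e
    using example_graph_quadratic[OF that] wf_digraph_preper_graph by (metis digraph_iso_reflI)
  have "inj_on example_graph (set examples)"
    using refl example_graph_iso_imp_eq by (metis inj_onI)
  moreover have "distinct examples"
    using examples_fingerprints by (simp only: distinct_map)
  ultimately have "card (example_graph ` set examples) = 46"
    by (simp add: card_image distinct_card examples_lengths(1))
  moreover have "pairwise (\<lambda>G H. \<not> digraph_iso G H) (example_graph ` set examples)"
    by (rule pairwise_imageI) (use example_graph_iso_imp_eq in blast)
  ultimately show "\<exists>\<G> :: (complex option, complex option \<times> complex option) pre_digraph set.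
            card \<G> \<ge> 46
          \<and> (\<forall>G\<in>\<G>. \<exists>K f. quadratic_field K \<and> quadratic_poly_over K f \<and> G = preper_graph f K)
          \<and> pairwise (\<lambda>G H. \<not> digraph_iso G H) \<G>"
    using example_graph_quadratic by (intro exI[of _ "example_graph ` set examples"]) auto
qed

end
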